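(* Let $\delta\ge 1$ be an integer and let $\delta\Delta_2=\operatorname{conv}\{(0,0),(\delta,0),(0,\delta)\}\subset\mathbb{R}^2$. A function $\omega:\delta\Delta_2\cap\mathbb{Z}^2\to\mathbb{R}$ induces the honeycomb triangulation on $\delta\Delta_2$ if and only if the following strict linear inequalities are satisfied for all integers $i,j\ge 1$ with $i+j\le\delta$: (1) $\omega(i-1,j-1)+\omega(i,j)>\omega(i-1,j)+\omega(i,j-1)$, (2) $\omega(i-1,j)+\omega(i+1,j-1)>\omega(i,j-1)+\omega(i,j)$, and (3) $\omega(i,j-1)+\omega(i-1,j+1)>\omega(i-1,j)+\omega(i,j)$.
   Context: The honeycomb triangulation of $\delta\Delta_2$ is the triangulation obtained by subdividing $\delta\Delta_2$ along all lines $x=k$, $y=k$, $x+y=k$ with $k\in\mathbb{Z}$. (Equivalently, it is the image, under the linear map $(z_1,z_2)\mapsto(z_1-z_2,z_2)$, of the triangulation of $\operatorname{conv}\{(0,0),(\delta,0),(\delta,\delta)\}$ cut out by the lines $z_1=k$, $z_2=k$, $z_1-z_2=k$, $k\in\mathbb{Z}$.) Its vertices are all the lattice points of $\delta\Delta_2$. A function $\omega:\mathcal{A}\to\mathbb{R}$ on $\mathcal{A}=\delta\Delta_2\cap\mathbb{Z}^2$ induces a triangulation $T$ if $T$ is the image of the lower convex hull of the lifted points $\{(a,\omega(a))\mid a\in\mathcal{A}\}\subset\mathbb{R}^3$ under the projection omitting the last coordinate; equivalently, for every triangle of $T$ the affine function agreeing with $\omega$ at its three vertices is strictly smaller than $\omega$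 at all other points of $\mathcal{A}$. *)

theory Defs
  imports "HOL-Analysis.Analysis"
begin

definition dilated_simplex :: "int \<Rightarrow> (real \<times> real) set" where
  "dilated_simplex \<delta> =
     convex hull {(0, 0), (real_of_int \<delta>, 0), (0, real_of_int \<delta>)}"

text \<open>
  A hyperplane \<open>{x. a \<bullet> x = b}\<close> is encoded as the pair \<open>(a, b)\<close>.  Two points of \<open>S\<close> are
  equivalent if they lie on the same side of (or both on) every hyperplane of \<open>H\<close>; the
  closures of the equivalence classes are the cells, of all dimensions, into which the
  arrangement \<open>H\<close> cuts \<open>S\<close>.
\<close>

definition subdivide_along :: "('a::euclidean_space \<times> real) set \<Rightarrow> 'a set \<Rightarrow> 'a set set" where
  "subdivide_along H S =
     (\<lambda>x. closure {y \<in> S. \<forall>(a, b) \<in> H. sgn (a \<bullet> y - b) = sgn (a \<bullet> x - b)}) ` S"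

definition honeycomb_lines :: "((real \<times> real) \<times> real) set" where
  "honeycomb_lines = {(1, 0), (0, 1), (1, 1)} \<times> \<int>"

text \<open>
  A triangulation is represented, as a polyhedral complex, by the set of all its nonempty
  cells (vertices, edges and triangles).
\<close>

definition honeycomb_triangulation :: "int \<Rightarrow> (real \<times> real) set set" where
  "honeycomb_triangulation \<delta> = subdivide_along honeycomb_lines (dilated_simplex \<delta>)"

definition lifted_points :: "int \<Rightarrow> (int \<times> int \<Rightarrow> real) \<Rightarrow> ((real \<times> real) \<times> real) set" where
  "lifted_points \<delta> \<omega> =
     {((real_of_int i, real_of_int j), \<omega> (i, j)) | i j.
        (real_of_int i, real_of_int j) \<in> dilated_simplex \<delta>}"

text \<open>
  The lower hull consists of the nonempty faces that have a supporting hyperplane whose outer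
  normal points strictly downwards.
\<close>

definition lower_faces :: "('a::euclidean_space \<times> real) set \<Rightarrow> ('a \<times> real) set set" where
  "lower_faces P =
     {F. F \<noteq> {} \<and> (\<exists>n b. snd n < 0 \<and> P \<subseteq> {p. n \<bullet> p \<le> b} \<and> F = P \<inter> {p. n \<bullet> p = b})}"

definition induces_triangulation ::
    "int \<Rightarrow> (int \<times> int \<Rightarrow> real) \<Rightarrow> (real \<times> real) set set \<Rightarrow> bool" where
  "induces_triangulation \<delta> \<omega> T \<longleftrightarrow>
     (\<lambda>F. fst ` F) ` lower_faces (convex hull (lifted_points \<delta> \<omega>)) = T"

end

theory Submission
  imports Defs
begin

text \<open>
  Each inequality says that \<open>\<omega>\<close> is strictly convex across one interior edge of the honeycomb.
  Summing two of them shows that the difference of \<open>\<omega>\<close> in the direction of any edge is monotone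
  in both coordinates.  After subtracting the affine function that agrees with \<open>\<omega>\<close> on a
  honeycomb triangle, \<open>\<omega>\<close> therefore increases along monotone lattice paths leading away from
  that triangle and is positive at all other lattice points.

  The projected lower faces are the convex hulls of the contact sets
  \<open>{a. l a = \<omega> a}\<close> of the affine functions \<open>l \<le> \<omega>\<close>.  Every face of a honeycomb triangle arises in
  this way by tilting the interpolating affine function slightly.  Conversely, the barycenter
  of a contact set lies in some honeycomb triangle, and comparing \<open>l\<close> with the affine function
  interpolating \<open>\<omega>\<close> on that triangle shows that the contact set consists of its vertices.  For
  the other direction of the theorem, if an edge is the hull of a contact set, then
  \<open>\<omega> > l\<close> at the two vertices opposite to the edge.
\<close>

section \<open>Local convexity implies global convexity\<close>

definition lattice_points :: "int \<Rightarrow> (int \<times> int) set" where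
  "lattice_points \<delta> = {(i, j). 0 \<le> i \<and> 0 \<le> j \<and> i + j \<le> \<delta>}"

definition emb :: "int \<times> int \<Rightarrow> real \<times> real" where
  "emb a = (real_of_int (fst a), real_of_int (snd a))"

text \<open>
  With \<open>\<sigma> = 1\<close> these are the vertices of the triangles \<open>\<triangle>\<close>, with \<open>\<sigma> = -1\<close> those of the
  triangles \<open>\<nabla>\<close> of the honeycomb.
\<close>

definition tri :: "int \<Rightarrow> int \<Rightarrow> int \<Rightarrow> (int \<times> int) set" where
  "tri \<sigma> p q = {(p, q), (p + \<sigma>, q), (p, q + \<sigma>)}"

text \<open>The inequalities of the theorem with \<open>(i, j)\<close> shifted by \<open>(1, 1)\<close>.\<close>

definition locally_convex :: "int \<Rightarrow> (int \<times> int \<Rightarrow> real) \<Rightarrow> bool" where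
  "locally_convex \<delta> f \<longleftrightarrow> (\<forall>i j. 0 \<le> i \<and> 0 \<le> j \<and> i + j + 2 \<le> \<delta> \<longrightarrow>
     f (i, j) + f (i + 1, j + 1) > f (i, j + 1) + f (i + 1, j) \<and>
     f (i, j + 1) + f (i + 2, j) > f (i + 1, j) + f (i + 1, j + 1) \<and>
     f (i + 1, j) + f (i, j + 2) > f (i, j + 1) + f (i + 1, j + 1))"

lemma locally_convexD:
  assumes "locally_convex \<delta> f" "0 \<le> i" "0 \<le> j" "i + j + 2 \<le> \<delta>"
  shows "f (i, j) + f (i + 1, j + 1) > f (i, j + 1) + f (i + 1, j)"
    and "f (i, j + 1) + f (i + 2, j) > f (i + 1, j) + f (i + 1, j + 1)"
    and "f (i + 1, j) + f (i, j + 2) > f (i, j + 1) + f (i + 1, j + 1)"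
  using assms unfolding locally_convex_def by blast+

text \<open>The reflection in the diagonal keeps the first inequality and exchanges the other
  two.\<close>

lemma locally_convex_swap:
  assumes "locally_convex \<delta> f"
  shows "locally_convex \<delta> (\<lambda>(i, j). f (j, i))"
  unfolding locally_convex_def
  using locally_convexD[OF assms] by (auto simp: algebra_simps)

text \<open>With \<open>k = \<delta> - i - j\<close> this is the cyclic symmetry of the triples \<open>(i, j, k)\<close>.\<close>

lemma locally_convex_rotate:
  assumes "locally_convex \<delta> f"
  shows "locally_convex \<delta> (\<lambda>(i, j). f (\<delta> - i - j, i))"
  unfolding locally_convex_def
proof (intro allI impI)
  fix i j :: int
  assume a: "0 \<le> i \<and> 0 \<le> j \<and> i + j + 2 \<le> \<delta>"
  \<comment> \<open>With this \<open>k\<close> the three rotated inequalities are those of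
    \<open>f\<close> at the base point \<open>(k, i)\<close>, cyclically permuted.\<close>
  define k where "k = \<delta> - i - j - 2"
  have \<delta>: "\<delta> = i + j + 2 + k" and "0 \<le> k" "k + i + 2 \<le> \<delta>"
    using a by (auto simp: k_def)
  from locally_convexD[OF assms this(2) _ this(3)] a
  show "(case (i, j) of (i, j) \<Rightarrow> f (\<delta> - i - j, i)) + (case (i + 1, j + 1) of (i, j) \<Rightarrow> f (\<delta> - i - j, i)) >
      (case (i, j + 1) of (i, j) \<Rightarrow> f (\<delta> - i - j, i)) + (case (i + 1, j) of (i, j) \<Rightarrow> f (\<delta> - i - j, i)) \<and>
      (case (i, j + 1) of (i, j) \<Rightarrow> f (\<delta> - i - j, i)) + (case (i + 2, j) of (i, j) \<Rightarrow> f (\<delta> - i - j, i)) >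
      (case (i + 1, j) of (i, j) \<Rightarrow> f (\<delta> - i - j, i)) + (case (i + 1, j + 1) of (i, j) \<Rightarrow> f (\<delta> - i - j, i)) \<and>
      (case (i + 1, j) of (i, j) \<Rightarrow> f (\<delta> - i - j, i)) + (case (i, j + 2) of (i, j) \<Rightarrow> f (\<delta> - i - j, i)) >
      (case (i, j + 1) of (i, j) \<Rightarrow> f (\<delta> - i - j, i)) + (case (i + 1, j + 1) of (i, j) \<Rightarrow> f (\<delta> - i - j, i))"
    by (simp add: \<delta> algebra_simps)
qed

section \<open>Monotone differences and monotone lattice paths\<close>

text \<open>Raising \<open>j\<close> by one is the first inequality; raising \<open>i\<close> by one
  is convexity along a row, the sum of the first two. The path goes along the row first, then
  up.\<close>

lemma difference_mono:
  assumes f: "locally_convex \<delta> f"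
    and "0 \<le> i" "i \<le> i'" "0 \<le> j" "j \<le> j'" "i' + 1 + j' \<le> \<delta>"
  shows "f (i + 1, j) - f (i, j) \<le> f (i' + 1, j') - f (i', j')"
proof -
  have "i' + 1 + j \<le> \<delta> \<longrightarrow> f (i + 1, j) - f (i, j) \<le> f (i' + 1, j) - f (i', j)"
    using \<open>i \<le> i'\<close>
  proof (induction rule: int_ge_induct)
    case (step k)
    then show ?case
      using locally_convexD(1,2)[OF f, of k j] assms(2,4) by (fastforce simp: algebra_simps)
  qed simp
  moreover have "i' + 1 + j' \<le> \<delta> \<longrightarrow>
      f (i' + 1, j) - f (i', j) \<le> f (i' + 1, j') - f (i', j')"
    using \<open>j \<le> j'\<close>
  proof (induction rule: int_ge_induct)
    case (step k)
    then show ?case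
      using locally_convexD(1)[OF f, of i' k] assms(2,3,4) by (fastforce simp: algebra_simps)
  qed simp
  ultimately show ?thesis using assms by linarith
qed

lemma difference_mono':
  assumes f: "locally_convex \<delta> f"
    and "0 \<le> i" "i \<le> i'" "0 \<le> j" "j \<le> j'" "i' + 1 + j' \<le> \<delta>"
  shows "f (j, i + 1) - f (j, i) \<le> f (j', i' + 1) - f (j', i')"
  using difference_mono[OF locally_convex_swap[OF f] assms(2-)] by simp

text \<open>Differences to the upper right of \<open>(p, q)\<close> are at least those at
  \<open>(p, q)\<close>, which \<open>D1\<close> and \<open>D2\<close> make nonnegative. If the
  neighbours of \<open>(p, q)\<close> lie outside the domain, there is no step to take.\<close>

lemma mono_above:
  assumes f: "locally_convex \<delta> f" and pq: "0 \<le> p" "0 \<le> q"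
    and D1: "p + 1 + q \<le> \<delta> \<Longrightarrow> f (p, q) \<le> f (p + 1, q)"
    and D2: "p + 1 + q \<le> \<delta> \<Longrightarrow> f (p, q) \<le> f (p, q + 1)"
    and le: "p \<le> i" "i \<le> i'" "q \<le> j" "j \<le> j'" "i' + j' \<le> \<delta>"
  shows "f (i, j) \<le> f (i', j')"
proof -
  have "i' + j \<le> \<delta> \<longrightarrow> f (i, j) \<le> f (i', j)"
    using \<open>i \<le> i'\<close>
  proof (induction rule: int_ge_induct)
    case (step k)
    then show ?case
      using difference_mono[OF f, of p k q j] D1 pq le by fastforce
  qed simp
  moreover have "i' + j' \<le> \<delta> \<longrightarrow> f (i', j) \<le> f (i', j')"
    using \<open>j \<le> j'\<close>
  proof (induction rule: int_ge_induct)
    case (step k)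
    then show ?case
      using difference_mono'[OF f, of q k p i'] D2 pq le by fastforce
  qed simp
  ultimately show ?thesis using le by linarith
qed

text \<open>Differences to the lower left are at most the last ones before \<open>(p, q)\<close>,
  which \<open>D1\<close> and \<open>D2\<close> make nonpositive.\<close>

lemma antimono_below:
  assumes f: "locally_convex \<delta> f" and pq: "p + q \<le> \<delta>"
    and D1: "1 \<le> p \<Longrightarrow> 0 \<le> q \<Longrightarrow> f (p, q) \<le> f (p - 1, q)"
    and D2: "1 \<le> q \<Longrightarrow> 0 \<le> p \<Longrightarrow> f (p, q) \<le> f (p, q - 1)"
    and le: "0 \<le> i" "i \<le> i'" "i' \<le> p" "0 \<le> j" "j \<le> j'" "j' \<le> q"
  shows "f (i', j') \<le> f (i, j)"
proof -
  have "0 \<le> i \<longrightarrow> f (i', j') \<le> f (i, j')"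
    using \<open>i \<le> i'\<close>
  proof (induction rule: int_le_induct)
    case (step k)
    then show ?case
      using difference_mono[OF f, of "k - 1" "p - 1" j' q] D1 pq le by fastforce
  qed simp
  moreover have "0 \<le> j \<longrightarrow> f (i, j') \<le> f (i, j)"
    using \<open>j \<le> j'\<close>
  proof (induction rule: int_le_induct)
    case (step k)
    then show ?case
      using difference_mono'[OF f, of "k - 1" "q - 1" i p] D2 pq le by fastforce
  qed simp
  ultimately show ?thesis using le by linarith
qed

lemma row_convex:
  assumes f: "locally_convex \<delta> f" and "0 \<le> i" "0 \<le> j" "i + 2 + j \<le> \<delta>"
  shows "f (i, j) + f (i + 2, j) > 2 * f (i + 1, j)"
  using locally_convexD(1,2)[OF f, of i j] assms by simp

lemma column_convex:
  assumes f: "locally_convex \<delta> f" and "0 \<le> i" "0 \<le> j" "i + 2 + j \<le> \<delta>"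
  shows "f (i, j) + f (i, j + 2) > 2 * f (i, j + 1)"
  using locally_convexD(1,3)[OF f, of i j] assms by simp

section \<open>Positivity off a triangle of zeros\<close>

text \<open>Two neighbouring zeros in a row or column, or three zeros at corners of a unit square,
  make the next lattice point positive by strict convexity. Monotone paths carry this to the rest of
  the quadrant.\<close>

lemma pos_quadrant:
  assumes f: "locally_convex \<delta> f" and \<sigma>: "\<sigma> = 1 \<or> \<sigma> = -1"
    and T: "tri \<sigma> p q \<subseteq> lattice_points \<delta>" and zero: "\<And>v. v \<in> tri \<sigma> p q \<Longrightarrow> f v = 0"
    and ij: "0 \<le> i" "0 \<le> j" "i + j \<le> \<delta>" "(i, j) \<notin> tri \<sigma> p q"
    and quad: "p \<le> i \<and> q \<le> j \<or> i \<le> p \<and> j \<le> q"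
  shows "f (i, j) > 0"
proof -
  have z: "f (p, q) = 0" "f (p + \<sigma>, q) = 0" "f (p, q + \<sigma>) = 0"
    using zero by (auto simp: tri_def)
  have dom: "0 \<le> p" "0 \<le> q" "p + q \<le> \<delta>" "0 \<le> p + \<sigma>" "0 \<le> q + \<sigma>" "p + q + \<sigma> \<le> \<delta>"
    using T by (auto simp: tri_def lattice_points_def)
  have ne: "(i, j) \<noteq> (p, q)" "(i, j) \<noteq> (p + \<sigma>, q)" "(i, j) \<noteq> (p, q + \<sigma>)"
    using ij(4) by (auto simp: tri_def)
  note row = row_convex[OF f] and col = column_convex[OF f]
  show ?thesis
  proof (cases "\<sigma> = 1")
    case True
    show ?thesis
    proof (cases "p \<le> i \<and> q \<le> j")
      case up: True
      have M: "f (i', j') \<le> f (i, j)" if "p \<le> i'" "i' \<le> i" "q \<le> j'" "j' \<le> j" for i' j'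
        by (rule mono_above[OF f, of p q]) (use that z True dom ij in auto)
      \<comment> \<open>One case for each of the three minimal points of the quadrant outside the
        triangle.\<close>
      consider "p + 2 \<le> i" | "p + 1 \<le> i" "q + 1 \<le> j" | "q + 2 \<le> j"
        using up ne True by fastforce
      then show ?thesis
      proof cases
        case 1
        then show ?thesis using M[of "p + 2" q] row[of p q] z True dom up ij by (simp add: algebra_simps)
      next
        case 2
        then show ?thesis
          using M[of "p + 1" "q + 1"] locally_convexD(1)[OF f, of p q] z True dom up ij by (simp add: algebra_simps)
      next
        case 3
        then show ?thesis using M[of p "q + 2"] col[of p q] z True dom up ij by (simp add: algebra_simps)
      qed
    next
      case False
      then have dn: "i \<le> p" "j \<le> q" "i < p \<or> j < q" using quad by auto
      \<comment> \<open>This quadrant meets the triangle only in \<open>(p, q)\<close>. The zeros at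
        \<open>(p, q)\<close> and \<open>(p + 1, q)\<close> push \<open>f\<close> up on the other
        side.\<close>
      have D1: "f (p - 1, q) > 0" if "1 \<le> p"
        using row[of "p - 1" q] z True dom that by (simp add: algebra_simps)
      have D2: "f (p, q - 1) > 0" if "1 \<le> q"
        using col[of p "q - 1"] z True dom that by (simp add: algebra_simps)
      have M: "f (i', j') \<le> f (i, j)" if "i \<le> i'" "i' \<le> p" "j \<le> j'" "j' \<le> q" for i' j'
        by (rule antimono_below[OF f, of p q]) (use that z True dom ij D1 D2 in auto)
      show ?thesis
        using dn M[of "p - 1" q] M[of p "q - 1"] D1 D2 ij by fastforce
    qed
  next
    case False
    then have m: "\<sigma> = -1" using \<sigma> by simp
    show ?thesis
    proof (cases "p \<le> i \<and> q \<le> j")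
      case up: True
      have D1: "f (p + 1, q) > 0" if "p + 1 + q \<le> \<delta>"
        using row[of "p - 1" q] z m dom that by (simp add: algebra_simps)
      have D2: "f (p, q + 1) > 0" if "p + 1 + q \<le> \<delta>"
        using col[of p "q - 1"] z m dom that by (simp add: algebra_simps)
      have M: "f (i', j') \<le> f (i, j)" if "p \<le> i'" "i' \<le> i" "q \<le> j'" "j' \<le> j" for i' j'
        by (rule mono_above[OF f, of p q]) (use that z m dom ij D1 D2 in auto)
      show ?thesis
        using up ne M[of "p + 1" q] M[of p "q + 1"] D1 D2 ij by fastforce
    next
      case False
      then have dn: "i \<le> p" "j \<le> q" using quad by auto
      have M: "f (i', j') \<le> f (i, j)" if "i \<le> i'" "i' \<le> p" "j \<le> j'" "j' \<le> q" for i' j'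
        by (rule antimono_below[OF f, of p q]) (use that z m dom ij in auto)
      \<comment> \<open>Mirror image of the first case: one case for each maximal point of the lower
        left quadrant outside the triangle.\<close>
      consider "i \<le> p - 2" | "i \<le> p - 1" "j \<le> q - 1" | "j \<le> q - 2"
        using dn ne m by fastforce
      then show ?thesis
      proof cases
        case 1
        then show ?thesis using M[of "p - 2" q] row[of "p - 2" q] z m dom dn ij by (simp add: algebra_simps)
      next
        case 2
        then show ?thesis
          using M[of "p - 1" "q - 1"] locally_convexD(1)[OF f, of "p - 1" "q - 1"] z m dom dn ij
          by (simp add: algebra_simps)
      next
        case 3
        then show ?thesis using M[of p "q - 2"] col[of p "q - 2"] z m dom dn ij by (simp add: algebra_simps)
      qed
    qed
  qed
qed

text \<open>
  Of the three differences of the coordinates \<open>(i, j, k)\<close> of \<open>a\<close> to those of the triangle, two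
  have the same sign, and the cyclic symmetry moves these two to the first two places.
\<close>

lemma pos_off_triangle:
  assumes f: "locally_convex \<delta> f" and \<sigma>: "\<sigma> = 1 \<or> \<sigma> = -1"
    and T: "tri \<sigma> p q \<subseteq> lattice_points \<delta>" and zero: "\<And>v. v \<in> tri \<sigma> p q \<Longrightarrow> f v = 0"
    and a: "a \<in> lattice_points \<delta>" "a \<notin> tri \<sigma> p q"
  shows "f a > 0"
proof -
  obtain i j where [simp]: "a = (i, j)" by (cases a)
  \<comment> \<open>The third coordinates: the vertices of the triangle are the triples
    \<open>(p, q, r)\<close> with \<sigma> added in one place.\<close>
  define r k where "r = \<delta> - p - q - \<sigma>" and "k = \<delta> - i - j"
  \<comment> \<open>By construction \<open>g (j, k)\<close> and \<open>h (k, i)\<close> both equal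
    \<open>f (i, j)\<close>.\<close>
  define g where "g = (\<lambda>(i, j). f (\<delta> - i - j, i))"
  define h where "h = (\<lambda>(i, j). g (\<delta> - i - j, i))"
  have g: "locally_convex \<delta> g" and h: "locally_convex \<delta> h"
    unfolding h_def g_def by (intro locally_convex_rotate f)+
  have "k + i + j = r + p + q + \<sigma>" by (simp add: r_def k_def)
  then consider "p \<le> i \<and> q \<le> j \<or> i \<le> p \<and> j \<le> q" | "q \<le> j \<and> r \<le> k \<or> j \<le> q \<and> k \<le> r"
    | "r \<le> k \<and> p \<le> i \<or> k \<le> r \<and> i \<le> p"
    by linarith
  then show ?thesis
  proof cases
    case 1
    then show ?thesis
      using pos_quadrant[OF f \<sigma> T zero, of i j] a by (auto simp: lattice_points_def)
  next
    case 2
    have "g (j, k) > 0"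
    proof (rule pos_quadrant[OF g \<sigma>, of q r])
      show "tri \<sigma> q r \<subseteq> lattice_points \<delta>" "(j, k) \<notin> tri \<sigma> q r"
        using T a by (auto simp: tri_def lattice_points_def r_def k_def)
      show "g v = 0" if "v \<in> tri \<sigma> q r" for v
        using that zero by (auto simp: tri_def g_def r_def)
    qed (use a 2 in \<open>auto simp: lattice_points_def k_def\<close>)
    then show ?thesis by (simp add: g_def k_def)
  next
    case 3
    have "h (k, i) > 0"
    proof (rule pos_quadrant[OF h \<sigma>, of r p])
      show "tri \<sigma> r p \<subseteq> lattice_points \<delta>" "(k, i) \<notin> tri \<sigma> r p"
        using T a by (auto simp: tri_def lattice_points_def r_def k_def)
      show "h v = 0" if "v \<in> tri \<sigma> r p" for v
        using that zero by (auto simp: tri_def h_def g_def r_def)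
    qed (use a 3 in \<open>auto simp: lattice_points_def k_def\<close>)
    then show ?thesis by (simp add: g_def h_def k_def)
  qed
qed

section \<open>The cells of the honeycomb triangulation\<close>

text \<open>
  The barycentric coordinate of \<open>y\<close> belonging to the vertex \<open>v\<close> of \<open>tri \<sigma> p q\<close>; the last
  branch is meant for \<open>v = (p, q)\<close>.
\<close>

definition bary :: "int \<Rightarrow> int \<Rightarrow> int \<Rightarrow> int \<times> int \<Rightarrow> real \<times> real \<Rightarrow> real" where
  "bary \<sigma> p q v y =
     (if v = (p + \<sigma>, q) then real_of_int \<sigma> * (fst y - real_of_int p)
      else if v = (p, q + \<sigma>) then real_of_int \<sigma> * (snd y - real_of_int q)
      else 1 - real_of_int \<sigma> * (fst y - real_of_int p) - real_of_int \<sigma> * (snd y - real_of_int q))"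

text \<open>Cells are recorded by their vertex sets. Every nonempty set of vertices of a triangle
  spans a face, so cells of all dimensions occur.\<close>

definition honeycomb_cells :: "int \<Rightarrow> (int \<times> int) set set" where
  "honeycomb_cells \<delta> = {V. V \<noteq> {} \<and>
     (\<exists>\<sigma> p q. (\<sigma> = 1 \<or> \<sigma> = -1) \<and> tri \<sigma> p q \<subseteq> lattice_points \<delta> \<and> V \<subseteq> tri \<sigma> p q)}"

definition contact :: "int \<Rightarrow> (int \<times> int \<Rightarrow> real) \<Rightarrow> real \<times> real \<Rightarrow> real \<Rightarrow> (int \<times> int) set" where
  "contact \<delta> \<omega> c d = {a \<in> lattice_points \<delta>. c \<bullet> emb a + d = \<omega> a}"

section \<open>Lattice points of the simplex and two auxiliary facts\<close>

lemma finite_lattice_points: "finite (lattice_points \<delta>)"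
proof (rule finite_subset)
  show "lattice_points \<delta> \<subseteq> {0..\<delta>} \<times> {0..\<delta>}" by (auto simp: lattice_points_def)
qed simp

lemma dilated_simplex_eq:
  assumes "\<delta> \<ge> 1"
  shows "dilated_simplex \<delta> = {y. 0 \<le> fst y \<and> 0 \<le> snd y \<and> fst y + snd y \<le> real_of_int \<delta>}"
proof (intro equalityI subsetI)
  fix y assume "y \<in> dilated_simplex \<delta>"
  then obtain u v w :: real where "0 \<le> u" "0 \<le> v" "0 \<le> w" "u + v + w = 1" "y = (v * \<delta>, w * \<delta>)"
    by (auto simp: dilated_simplex_def convex_hull_3)
  moreover have "(v + w) * real_of_int \<delta> \<le> 1 * real_of_int \<delta>"
    using calculation assms by (intro mult_right_mono) auto
  ultimately show "y \<in> {y. 0 \<le> fst y \<and> 0 \<le> snd y \<and> fst y + snd y \<le> real_of_int \<delta>}"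
    using assms by (auto simp: algebra_simps)
next
  fix y :: "real \<times> real"
  assume y: "y \<in> {y. 0 \<le> fst y \<and> 0 \<le> snd y \<and> fst y + snd y \<le> real_of_int \<delta>}"
  let ?v = "fst y / \<delta>" and ?w = "snd y / \<delta>"
  have "y = (1 - ?v - ?w) *\<^sub>R (0, 0) + ?v *\<^sub>R (real_of_int \<delta>, 0) + ?w *\<^sub>R (0, real_of_int \<delta>)"
    using assms by (simp add: prod_eq_iff)
  moreover have "0 \<le> 1 - ?v - ?w" "0 \<le> ?v" "0 \<le> ?w" "(1 - ?v - ?w) + ?v + ?w = 1"
    using y assms divide_le_eq_1[of "fst y + snd y" "real_of_int \<delta>"]
    by (auto simp: add_divide_distrib)
  ultimately show "y \<in> dilated_simplex \<delta>"
    unfolding dilated_simplex_def convex_hull_3 by blast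
qed

lemma emb_in_dilated_simplex:
  assumes "\<delta> \<ge> 1"
  shows "emb a \<in> dilated_simplex \<delta> \<longleftrightarrow> a \<in> lattice_points \<delta>"
proof -
  have "real_of_int (fst a) + real_of_int (snd a) \<le> real_of_int \<delta> \<longleftrightarrow> fst a + snd a \<le> \<delta>"
    by linarith
  then show ?thesis
    by (auto simp: dilated_simplex_eq[OF assms] lattice_points_def emb_def split: prod.splits)
qed

lemma affine_sum:
  fixes c :: "'a::real_inner"
  assumes "sum w I = 1"
  shows "c \<bullet> (\<Sum>i\<in>I. w i *\<^sub>R z i) + d = (\<Sum>i\<in>I. w i * (c \<bullet> z i + d))"
proof -
  have "(\<Sum>i\<in>I. w i * (c \<bullet> z i + d)) = (\<Sum>i\<in>I. w i * (c \<bullet> z i)) + sum w I * d"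
    by (simp add: distrib_left sum.distrib sum_distrib_right)
  then show ?thesis by (simp add: inner_sum_right assms)
qed

text \<open>Only the shifts \<open>0\<close> and \<open>-1\<close> can change sign on the unit
  interval. This is why a honeycomb triangle is not cut by lines parallel to its edges.\<close>

lemma sgn_add_int:
  fixes b b' :: real
  assumes "0 \<le> b" "b \<le> 1" "0 \<le> b'" "b' \<le> 1" "b = 0 \<longleftrightarrow> b' = 0" "b = 1 \<longleftrightarrow> b' = 1"
  shows "sgn (b + of_int n) = sgn (b' + of_int n)"
proof -
  consider "1 \<le> n" | "n = 0" | "n = -1" | "n \<le> -2" by linarith
  then show ?thesis
  proof cases
    case 1
    then have "1 \<le> real_of_int n" by linarith
    then have "0 < b + of_int n" "0 < b' + of_int n" using assms by linarith+
    then show ?thesis by simp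
  next
    case 4
    then have "real_of_int n \<le> -2" by linarith
    then have "b + of_int n < 0" "b' + of_int n < 0" using assms by linarith+
    then show ?thesis by simp
  qed (use assms in \<open>auto simp: sgn_if\<close>)
qed

section \<open>Barycentric coordinates of a honeycomb triangle\<close>

lemma finite_tri [simp]: "finite (tri \<sigma> p q)"
  by (simp add: tri_def)

context
  fixes \<sigma> p q :: int
  assumes \<sigma>: "\<sigma> = 1 \<or> \<sigma> = -1"
begin

lemma ball_tri: "(\<forall>v\<in>tri \<sigma> p q. P v) \<longleftrightarrow> P (p, q) \<and> P (p + \<sigma>, q) \<and> P (p, q + \<sigma>)"
  by (simp add: tri_def)

lemma sum_tri: "sum f (tri \<sigma> p q) = f (p, q) + f (p + \<sigma>, q) + f (p, q + \<sigma>)"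
  using \<sigma> by (auto simp: tri_def add.assoc)

lemma bary_simps:
  "bary \<sigma> p q (p + \<sigma>, q) y = real_of_int \<sigma> * (fst y - real_of_int p)"
  "bary \<sigma> p q (p, q + \<sigma>) y = real_of_int \<sigma> * (snd y - real_of_int q)"
  "bary \<sigma> p q (p, q) y =
     1 - real_of_int \<sigma> * (fst y - real_of_int p) - real_of_int \<sigma> * (snd y - real_of_int q)"
  using \<sigma> by (auto simp: bary_def)

lemma sum_bary: "(\<Sum>v\<in>tri \<sigma> p q. bary \<sigma> p q v y) = 1"
  by (simp add: sum_tri bary_simps)

lemma sum_bary_scaleR: "(\<Sum>v\<in>tri \<sigma> p q. bary \<sigma> p q v y *\<^sub>R emb v) = y"
  unfolding sum_tri bary_simps using \<sigma> by (auto simp: emb_def prod_eq_iff algebra_simps)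

lemma bary_emb:
  assumes "v \<in> tri \<sigma> p q" "w \<in> tri \<sigma> p q"
  shows "bary \<sigma> p q v (emb w) = (if v = w then 1 else 0)"
  using assms \<sigma> by (auto simp: tri_def bary_def emb_def)

lemma bary_affine:
  assumes "s + t = 1"
  shows "bary \<sigma> p q v (s *\<^sub>R x + t *\<^sub>R y) = s * bary \<sigma> p q v x + t * bary \<sigma> p q v y"
proof -
  have s: "s = 1 - t" using assms by simp
  show ?thesis unfolding s by (simp add: bary_def algebra_simps)
qed

text \<open>A face of a triangle is cut out by the vanishing of the coordinates of the missing
  vertices; the coordinates themselves serve as convex weights.\<close>

lemma convex_hull_emb:
  assumes V: "V \<subseteq> tri \<sigma> p q"
  shows "convex hull (emb ` V) =
    {y. (\<forall>v\<in>tri \<sigma> p q. 0 \<le> bary \<sigma> p q v y) \<and> (\<forall>v\<in>tri \<sigma> p q - V. bary \<sigma> p q v y = 0)}"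
    (is "_ = ?C")
proof
  have "convex ?C"
    by (rule convexI) (simp add: bary_affine)
  moreover have "emb ` V \<subseteq> ?C"
    using V by (auto simp: bary_emb subset_iff)
  ultimately show "convex hull (emb ` V) \<subseteq> ?C"
    by (simp add: hull_minimal)
  show "?C \<subseteq> convex hull (emb ` V)"
  proof
    fix y assume y: "y \<in> ?C"
    have zero: "bary \<sigma> p q v y = 0" if "v \<in> tri \<sigma> p q - V" for v
      using y that by blast
    have "(\<Sum>v\<in>V. bary \<sigma> p q v y) = 1"
      using sum.mono_neutral_left[OF finite_tri V, of "\<lambda>v. bary \<sigma> p q v y"] zero sum_bary
      by simp
    moreover have "(\<Sum>v\<in>V. bary \<sigma> p q v y *\<^sub>R emb v) = y"
      using sum.mono_neutral_left[OF finite_tri V, of "\<lambda>v. bary \<sigma> p q v y *\<^sub>R emb v"] zero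
        sum_bary_scaleR by simp
    moreover have "(\<Sum>v\<in>V. bary \<sigma> p q v y *\<^sub>R emb v) \<in> convex hull (emb ` V)"
      using y V calculation(1) finite_subset[OF V finite_tri]
      by (intro convex_sum) (auto intro: hull_inc)
    ultimately show "y \<in> convex hull (emb ` V)" by simp
  qed
qed

text \<open>The sign class of \<open>x\<close> is the relative interior of the face spanned by the
  vertices with positive coordinate at \<open>x\<close>.\<close>

lemma closure_sgn_class:
  assumes x: "\<forall>v\<in>tri \<sigma> p q. 0 \<le> bary \<sigma> p q v x"
  shows "closure {y. \<forall>v\<in>tri \<sigma> p q. sgn (bary \<sigma> p q v y) = sgn (bary \<sigma> p q v x)} =
    convex hull (emb ` {v \<in> tri \<sigma> p q. 0 < bary \<sigma> p q v x})"
    (is "closure ?E = convex hull (emb ` ?V)")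
proof
  have "?V \<subseteq> tri \<sigma> p q" by blast
  note hull = convex_hull_emb[OF this]
  have "?E \<subseteq> convex hull (emb ` ?V)"
    unfolding hull
  proof (intro subsetI CollectI conjI ballI)
    fix y v assume y: "y \<in> ?E"
    {
      assume "v \<in> tri \<sigma> p q"
      then have "sgn (bary \<sigma> p q v y) = sgn (bary \<sigma> p q v x)" "0 \<le> bary \<sigma> p q v x"
        using x y by auto
      then show "0 \<le> bary \<sigma> p q v y" by (auto simp: sgn_if split: if_splits)
    }
    {
      assume "v \<in> tri \<sigma> p q - ?V"
      then have "v \<in> tri \<sigma> p q" "\<not> 0 < bary \<sigma> p q v x" by auto
      then have "sgn (bary \<sigma> p q v y) = sgn (bary \<sigma> p q v x)" "bary \<sigma> p q v x = 0"
        using x y by force+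
      then show "bary \<sigma> p q v y = 0" by (simp add: sgn_0_0)
    }
  qed
  moreover have "closed (convex hull (emb ` ?V))"
    by (simp add: compact_imp_closed finite_imp_compact_convex_hull)
  ultimately show "closure ?E \<subseteq> convex hull (emb ` ?V)"
    by (rule closure_minimal)
  show "convex hull (emb ` ?V) \<subseteq> closure ?E"
  proof
    fix y assume "y \<in> convex hull (emb ` ?V)"
    then have y: "0 \<le> bary \<sigma> p q v y" "bary \<sigma> p q v x = 0 \<Longrightarrow> bary \<sigma> p q v y = 0"
      if "v \<in> tri \<sigma> p q" for v
      using that unfolding hull by force+
    \<comment> \<open>The points \<open>z n\<close> run from \<open>x\<close> to \<open>y\<close> on
      a segment; their positive weight on \<open>x\<close> keeps them in the sign class.\<close>
    define t z where "t = (\<lambda>n. inverse (real (Suc n)))"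
      and "z = (\<lambda>n. (1 - t n) *\<^sub>R y + t n *\<^sub>R x)"
    have t: "0 < t n" "t n \<le> 1" for n
      by (auto simp: t_def field_simps)
    have "sgn (bary \<sigma> p q v (z n)) = sgn (bary \<sigma> p q v x)" if v: "v \<in> tri \<sigma> p q" for n v
    proof (cases "bary \<sigma> p q v x = 0")
      case True
      then show ?thesis using y(2)[OF v] by (simp add: z_def bary_affine)
    next
      case False
      then have "0 < bary \<sigma> p q v x" using x v by force
      moreover from this have "0 < (1 - t n) * bary \<sigma> p q v y + t n * bary \<sigma> p q v x"
        using t[of n] y(1)[OF v] by (simp add: add_nonneg_pos)
      ultimately show ?thesis by (simp add: z_def bary_affine)
    qed
    then have "z n \<in> ?E" for n by blast
    moreover have "t \<longlonglongrightarrow> 0"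
      unfolding t_def by (rule LIMSEQ_inverse_real_of_nat)
    then have "z \<longlonglongrightarrow> (1 - 0) *\<^sub>R y + 0 *\<^sub>R x"
      unfolding z_def by (intro tendsto_intros)
    ultimately show "y \<in> closure ?E"
      unfolding closure_sequential by auto
  qed
qed

text \<open>Every honeycomb line is parallel to an edge of the triangle, at an integer distance in
  the scale of the coordinate belonging to the opposite vertex.\<close>

lemma line_level_eq_bary:
  assumes "(a, b) \<in> {(1, 0), (0, 1), (1, 1)} \<times> (\<int> :: real set)"
  shows "\<exists>v\<in>tri \<sigma> p q. \<exists>n s::int. (s = 1 \<or> s = -1) \<and>
    (\<forall>y. a \<bullet> y - b = real_of_int s * (bary \<sigma> p q v y + real_of_int n))"
proof -
  obtain m where m: "b = real_of_int m" using assms by (auto elim: Ints_cases)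
  consider "a = (1, 0)" | "a = (0, 1)" | "a = (1, 1)" using assms by auto
  then show ?thesis
  proof cases
    case 1
    have "\<forall>y. a \<bullet> y - b = real_of_int \<sigma> * (bary \<sigma> p q (p + \<sigma>, q) y + real_of_int (\<sigma> * (p - m)))"
      using \<sigma> by (auto simp: 1 m bary_simps inner_prod_def)
    moreover have "(p + \<sigma>, q) \<in> tri \<sigma> p q" by (simp add: tri_def)
    ultimately show ?thesis using \<sigma> by blast
  next
    case 2
    have "\<forall>y. a \<bullet> y - b = real_of_int \<sigma> * (bary \<sigma> p q (p, q + \<sigma>) y + real_of_int (\<sigma> * (q - m)))"
      using \<sigma> by (auto simp: 2 m bary_simps inner_prod_def)
    moreover have "(p, q + \<sigma>) \<in> tri \<sigma> p q" by (simp add: tri_def)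
    ultimately show ?thesis using \<sigma> by blast
  next
    case 3
    \<comment> \<open>The extra \<open>-1\<close> arises because the coordinate of
      \<open>(p, q)\<close> is one, not zero, on the parallel through \<open>(p, q)\<close>.\<close>
    have "\<forall>y. a \<bullet> y - b =
        real_of_int (- \<sigma>) * (bary \<sigma> p q (p, q) y + real_of_int (\<sigma> * (m - p - q) - 1))"
      using \<sigma> by (auto simp: 3 m bary_simps inner_prod_def)
    moreover have "- \<sigma> = 1 \<or> - \<sigma> = -1" using \<sigma> by auto
    moreover have "(p, q) \<in> tri \<sigma> p q" by (simp add: tri_def)
    ultimately show ?thesis by blast
  qed
qed

text \<open>The line in question carries the edge opposite to \<open>v\<close>.\<close>

lemma bary_eq_line_level:
  assumes "v \<in> tri \<sigma> p q"
  shows "\<exists>(a, b) \<in> honeycomb_lines. \<exists>s::int. (s = 1 \<or> s = -1) \<and>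
    (\<forall>y. bary \<sigma> p q v y = real_of_int s * (a \<bullet> y - b))"
proof -
  have s: "- \<sigma> = 1 \<or> - \<sigma> = -1" using \<sigma> by auto
  consider "v = (p + \<sigma>, q)" | "v = (p, q + \<sigma>)" | "v = (p, q)" using assms by (auto simp: tri_def)
  then show ?thesis
  proof cases
    case 1
    have "\<forall>y. bary \<sigma> p q v y = real_of_int \<sigma> * ((1, 0) \<bullet> y - real_of_int p)"
      by (simp add: 1 bary_simps inner_prod_def)
    moreover have "((1, 0), real_of_int p) \<in> honeycomb_lines" by (simp add: honeycomb_lines_def)
    ultimately show ?thesis using \<sigma> by blast
  next
    case 2
    have "\<forall>y. bary \<sigma> p q v y = real_of_int \<sigma> * ((0, 1) \<bullet> y - real_of_int q)"
      by (simp add: 2 bary_simps inner_prod_def)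
    moreover have "((0, 1), real_of_int q) \<in> honeycomb_lines" by (simp add: honeycomb_lines_def)
    ultimately show ?thesis using \<sigma> by blast
  next
    case 3
    have "\<forall>y. bary \<sigma> p q v y = real_of_int (- \<sigma>) * ((1, 1) \<bullet> y - real_of_int (p + q + \<sigma>))"
      using \<sigma> by (auto simp: 3 bary_simps inner_prod_def)
    moreover have "((1, 1), real_of_int (p + q + \<sigma>)) \<in> honeycomb_lines"
      unfolding honeycomb_lines_def by (intro SigmaI Ints_of_int) simp
    ultimately show ?thesis using s by blast
  qed
qed

lemma bary_sum:
  assumes "v \<in> tri \<sigma> p q" "sum w I = 1"
  shows "bary \<sigma> p q v (\<Sum>i\<in>I. w i *\<^sub>R z i) = (\<Sum>i\<in>I. w i * bary \<sigma> p q v (z i))"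
proof -
  from bary_eq_line_level[OF assms(1)] obtain a :: "real \<times> real" and b s
    where eq: "\<And>y. bary \<sigma> p q v y = real_of_int s * (a \<bullet> y - b)" by blast
  show ?thesis
    using affine_sum[OF assms(2), of a z "- b"] by (simp add: eq sum_distrib_left mult.left_commute)
qed

text \<open>Seen from a point of the triangle, the infinite arrangement reduces to the three lines
  carrying its edges: all other levels are integer shifts of the coordinates, settled by
  \<open>sgn_add_int\<close>.\<close>

lemma sgn_lines_eq_iff:
  assumes x: "\<forall>v\<in>tri \<sigma> p q. 0 \<le> bary \<sigma> p q v x"
  shows "(\<forall>(a, b)\<in>honeycomb_lines. sgn (a \<bullet> y - b) = sgn (a \<bullet> x - b)) \<longleftrightarrow>
    (\<forall>v\<in>tri \<sigma> p q. sgn (bary \<sigma> p q v y) = sgn (bary \<sigma> p q v x))" (is "?L \<longleftrightarrow> ?R")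
proof
  assume L: ?L
  show ?R
  proof
    fix v assume "v \<in> tri \<sigma> p q"
    from bary_eq_line_level[OF this] obtain a b s where ab: "(a, b) \<in> honeycomb_lines"
      and eq: "\<And>y. bary \<sigma> p q v y = real_of_int s * (a \<bullet> y - b)" by blast
    show "sgn (bary \<sigma> p q v y) = sgn (bary \<sigma> p q v x)"
      using L ab by (auto simp: eq sgn_mult)
  qed
next
  assume R: ?R
  have y: "0 \<le> bary \<sigma> p q v y" and zero: "bary \<sigma> p q v y = 0 \<longleftrightarrow> bary \<sigma> p q v x = 0"
    if "v \<in> tri \<sigma> p q" for v
  proof -
    have "sgn (bary \<sigma> p q v y) = sgn (bary \<sigma> p q v x)" "0 \<le> bary \<sigma> p q v x"
      using R x that by auto
    then show "0 \<le> bary \<sigma> p q v y" "bary \<sigma> p q v y = 0 \<longleftrightarrow> bary \<sigma> p q v x = 0"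
      by (auto simp: sgn_if split: if_splits)
  qed
  \<comment> \<open>A coordinate is one exactly when the other two vanish, so the signs also detect
    the value one.\<close>
  have one: "bary \<sigma> p q v z = 1 \<longleftrightarrow> (\<forall>w\<in>tri \<sigma> p q - {v}. bary \<sigma> p q w z = 0)"
    and le1: "bary \<sigma> p q v z \<le> 1"
    if v: "v \<in> tri \<sigma> p q" and z: "\<forall>v\<in>tri \<sigma> p q. 0 \<le> bary \<sigma> p q v z" for v z
  proof -
    have eq: "1 = bary \<sigma> p q v z + (\<Sum>w\<in>tri \<sigma> p q - {v}. bary \<sigma> p q w z)"
      using sum.remove[OF finite_tri v, of "\<lambda>w. bary \<sigma> p q w z"] sum_bary by simp
    have "(\<Sum>w\<in>tri \<sigma> p q - {v}. bary \<sigma> p q w z) = 0 \<longleftrightarrow>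
        (\<forall>w\<in>tri \<sigma> p q - {v}. bary \<sigma> p q w z = 0)"
      using z by (intro sum_nonneg_eq_0_iff) auto
    then show "bary \<sigma> p q v z = 1 \<longleftrightarrow> (\<forall>w\<in>tri \<sigma> p q - {v}. bary \<sigma> p q w z = 0)"
      using eq by linarith
    have "0 \<le> (\<Sum>w\<in>tri \<sigma> p q - {v}. bary \<sigma> p q w z)"
      using z by (intro sum_nonneg) auto
    then show "bary \<sigma> p q v z \<le> 1" using eq by linarith
  qed
  show ?L
  proof clarify
    fix a :: "real \<times> real" and b :: real
    assume "(a, b) \<in> honeycomb_lines"
    then obtain v n s where v: "v \<in> tri \<sigma> p q"
      and eq: "\<And>y. a \<bullet> y - b = real_of_int s * (bary \<sigma> p q v y + real_of_int n)"
      unfolding honeycomb_lines_def using line_level_eq_bary by blast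
    have "sgn (bary \<sigma> p q v y + real_of_int n) = sgn (bary \<sigma> p q v x + real_of_int n)"
      using v x y zero le1 by (intro sgn_add_int) (auto simp: one)
    then show "sgn (a \<bullet> y - b) = sgn (a \<bullet> x - b)"
      by (simp add: eq sgn_mult)
  qed
qed

lemma interpolate:
  "\<exists>c d. \<forall>v\<in>tri \<sigma> p q. c \<bullet> emb v + d = g v"
proof -
  \<comment> \<open>The slopes along the two legs; multiplying by \<sigma> is dividing by
    it.\<close>
  define c where "c = (real_of_int \<sigma> * (g (p + \<sigma>, q) - g (p, q)),
    real_of_int \<sigma> * (g (p, q + \<sigma>) - g (p, q)))"
  have "\<forall>v\<in>tri \<sigma> p q. c \<bullet> emb v + (g (p, q) - c \<bullet> emb (p, q)) = g v"
    using \<sigma> by (auto simp: tri_def c_def emb_def algebra_simps)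
  then show ?thesis by blast
qed

end

section \<open>Identification of the cells\<close>

text \<open>The integer parts of \<open>x\<close> give a unit square, which its antidiagonal splits
  into one triangle of each orientation.\<close>

lemma ex_triangle:
  assumes \<delta>: "\<delta> \<ge> 1" and x: "x \<in> dilated_simplex \<delta>"
  shows "\<exists>\<sigma> p q. (\<sigma> = 1 \<or> \<sigma> = -1) \<and> tri \<sigma> p q \<subseteq> lattice_points \<delta> \<and>
    (\<forall>v\<in>tri \<sigma> p q. 0 \<le> bary \<sigma> p q v x)"
proof -
  define i j where "i = \<lfloor>fst x\<rfloor>" and "j = \<lfloor>snd x\<rfloor>"
  have x': "0 \<le> fst x" "0 \<le> snd x" "fst x + snd x \<le> \<delta>"
    using x by (auto simp: dilated_simplex_eq[OF \<delta>])
  have i: "real_of_int i \<le> fst x" "fst x < real_of_int i + 1"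
    and j: "real_of_int j \<le> snd x" "snd x < real_of_int j + 1"
    unfolding i_def j_def by linarith+
  have ij0: "0 \<le> i" "0 \<le> j" "i + j \<le> \<delta>" using i j x' by linarith+
  consider "fst x + snd x \<le> real_of_int (i + j + 1)" "i + j + 1 \<le> \<delta>"
    | "i + j = \<delta>" | "fst x + snd x > real_of_int (i + j + 1)"
    using ij0 by linarith
  then show ?thesis
  proof cases
    case 1
    then show ?thesis
      using i j ij0
      by (intro exI[of _ 1] exI[of _ i] exI[of _ j])
        (auto simp: tri_def bary_def lattice_points_def)
  next
    case 2
    \<comment> \<open>Here \<open>x\<close> is a lattice point on the hypotenuse and the triangle
      with corner \<open>(i, j)\<close> would leave the simplex. A triangle one step below or to the
      left has \<open>x\<close> as a vertex.\<close>
    then have "real_of_int i + real_of_int j = real_of_int \<delta>" by simp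
    then have eq: "fst x = real_of_int i" "snd x = real_of_int j" using i j x' by linarith+
    show ?thesis
    proof (cases "i = 0")
      case True
      then show ?thesis
        using eq 2 \<delta>
        by (intro exI[of _ 1] exI[of _ i] exI[of _ "j - 1"])
          (auto simp: tri_def bary_def lattice_points_def)
    next
      case False
      then show ?thesis
        using eq 2 ij0
        by (intro exI[of _ 1] exI[of _ "i - 1"] exI[of _ j])
          (auto simp: tri_def bary_def lattice_points_def)
    qed
  next
    case 3
    \<comment> \<open>For integers this gives \<open>i + j + 2 \<le> \<delta>\<close>, so the corner
      \<open>(i + 1, j + 1)\<close> is still in the simplex.\<close>
    then have "i + j + 1 < \<delta>" using x' by linarith
    then show ?thesis
      using i j ij0 3
      by (intro exI[of _ "-1"] exI[of _ "i + 1"] exI[of _ "j + 1"])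
        (auto simp: tri_def bary_def lattice_points_def)
  qed
qed

lemma convex_hull_emb_subset:
  assumes "\<delta> \<ge> 1" "V \<subseteq> lattice_points \<delta>"
  shows "convex hull (emb ` V) \<subseteq> dilated_simplex \<delta>"
proof (rule hull_minimal)
  show "emb ` V \<subseteq> dilated_simplex \<delta>" using emb_in_dilated_simplex assms by auto
  show "convex (dilated_simplex \<delta>)" by (simp add: dilated_simplex_def)
qed

text \<open>Restricting to the simplex changes nothing, since the closure of the sign class is the
  hull of lattice points of the simplex.\<close>

lemma cell_of_point:
  assumes \<delta>: "\<delta> \<ge> 1" and \<sigma>: "\<sigma> = 1 \<or> \<sigma> = -1" and T: "tri \<sigma> p q \<subseteq> lattice_points \<delta>"
    and x: "\<forall>v\<in>tri \<sigma> p q. 0 \<le> bary \<sigma> p q v x"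
  shows "closure {y \<in> dilated_simplex \<delta>.
      \<forall>(a, b)\<in>honeycomb_lines. sgn (a \<bullet> y - b) = sgn (a \<bullet> x - b)} =
    convex hull (emb ` {v \<in> tri \<sigma> p q. 0 < bary \<sigma> p q v x})"
proof -
  let ?E = "{y. \<forall>v\<in>tri \<sigma> p q. sgn (bary \<sigma> p q v y) = sgn (bary \<sigma> p q v x)}"
  have "?E \<subseteq> closure ?E" by (rule closure_subset)
  also have "\<dots> \<subseteq> dilated_simplex \<delta>"
    unfolding closure_sgn_class[OF \<sigma> x] by (rule convex_hull_emb_subset[OF \<delta>]) (use T in auto)
  finally have "{y \<in> dilated_simplex \<delta>.
      \<forall>(a, b)\<in>honeycomb_lines. sgn (a \<bullet> y - b) = sgn (a \<bullet> x - b)} = ?E"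
    unfolding sgn_lines_eq_iff[OF \<sigma> x] by blast
  then show ?thesis by (simp only: closure_sgn_class[OF \<sigma> x])
qed

lemma honeycomb_triangulation_eq:
  assumes \<delta>: "\<delta> \<ge> 1"
  shows "honeycomb_triangulation \<delta> = (\<lambda>V. convex hull (emb ` V)) ` honeycomb_cells \<delta>"
proof (intro equalityI subsetI)
  fix C assume "C \<in> honeycomb_triangulation \<delta>"
  then obtain x where x: "x \<in> dilated_simplex \<delta>"
    and C: "C = closure {y \<in> dilated_simplex \<delta>.
      \<forall>(a, b)\<in>honeycomb_lines. sgn (a \<bullet> y - b) = sgn (a \<bullet> x - b)}"
    unfolding honeycomb_triangulation_def subdivide_along_def by blast
  from ex_triangle[OF \<delta> x] obtain \<sigma> p q where T: "\<sigma> = 1 \<or> \<sigma> = -1" "tri \<sigma> p q \<subseteq> lattice_points \<delta>"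
    "\<forall>v\<in>tri \<sigma> p q. 0 \<le> bary \<sigma> p q v x" by blast
  let ?V = "{v \<in> tri \<sigma> p q. 0 < bary \<sigma> p q v x}"
  have "?V \<noteq> {}"
  proof
    assume "?V = {}"
    then have "\<forall>v\<in>tri \<sigma> p q. bary \<sigma> p q v x = 0" using T(3) by force
    then show False using sum_bary[OF T(1), of p q x] by simp
  qed
  moreover have "?V \<subseteq> tri \<sigma> p q" by blast
  ultimately have "?V \<in> honeycomb_cells \<delta>" unfolding honeycomb_cells_def using T by blast
  then show "C \<in> (\<lambda>V. convex hull (emb ` V)) ` honeycomb_cells \<delta>"
    unfolding C cell_of_point[OF \<delta> T] by blast
next
  fix C assume "C \<in> (\<lambda>V. convex hull (emb ` V)) ` honeycomb_cells \<delta>"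
  then obtain V \<sigma> p q where C: "C = convex hull (emb ` V)" "V \<noteq> {}" and \<sigma>: "\<sigma> = 1 \<or> \<sigma> = -1"
    and T: "tri \<sigma> p q \<subseteq> lattice_points \<delta>" and V: "V \<subseteq> tri \<sigma> p q"
    unfolding honeycomb_cells_def by blast
  have "finite V" by (rule finite_subset[OF V finite_tri])
  \<comment> \<open>The barycenter of \<open>V\<close> has positive coordinates exactly at the
    vertices in \<open>V\<close>, so its class closes up to the hull of \<open>V\<close>.\<close>
  define w where "w = 1 / real (card V)"
  have w: "0 < w" "(\<Sum>a\<in>V. w) = 1"
    using \<open>V \<noteq> {}\<close> \<open>finite V\<close> by (auto simp: w_def card_gt_0_iff)
  define x where "x = (\<Sum>a\<in>V. w *\<^sub>R emb a)"
  have bx: "bary \<sigma> p q v x = (if v \<in> V then w else 0)" if v: "v \<in> tri \<sigma> p q" for v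
  proof -
    have "bary \<sigma> p q v x = (\<Sum>a\<in>V. w * bary \<sigma> p q v (emb a))"
      unfolding x_def by (rule bary_sum[OF \<sigma> v w(2)])
    also have "\<dots> = (\<Sum>a\<in>V. if a = v then w else 0)"
      using v V by (intro sum.cong) (auto simp: bary_emb[OF \<sigma>])
    finally show ?thesis using \<open>finite V\<close> by (simp add: sum.delta)
  qed
  have "\<forall>v\<in>tri \<sigma> p q. 0 \<le> bary \<sigma> p q v x"
    using bx w(1) by simp
  note cell = cell_of_point[OF \<delta> \<sigma> T this]
  have "{v \<in> tri \<sigma> p q. 0 < bary \<sigma> p q v x} = V"
    using bx V w(1) by (auto split: if_splits)
  moreover have "x \<in> convex hull (emb ` V)"
    unfolding x_def using \<open>finite V\<close> w by (intro convex_sum) (auto intro: hull_inc)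
  then have "x \<in> dilated_simplex \<delta>"
    using convex_hull_emb_subset[OF \<delta>] V T by blast
  ultimately show "C \<in> honeycomb_triangulation \<delta>"
    unfolding C honeycomb_triangulation_def subdivide_along_def using cell by auto
qed

section \<open>Lower faces and contact sets\<close>

text \<open>A face of the hull of a finite set is the hull of some of its points, and these must lie
  on the hyperplane.\<close>

lemma supporting_convex_hull:
  fixes L :: "'a::euclidean_space set"
  assumes "finite L" and le: "\<And>p. p \<in> L \<Longrightarrow> n \<bullet> p \<le> b"
  shows "convex hull L \<inter> {p. n \<bullet> p = b} = convex hull (L \<inter> {p. n \<bullet> p = b})"
proof
  have "convex hull L \<subseteq> {p. n \<bullet> p \<le> b}"
    using le by (intro hull_minimal) (auto simp: convex_halfspace_le)
  then have "(convex hull L \<inter> {p. n \<bullet> p = b}) face_of (convex hull L)"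
    by (intro face_of_Int_supporting_hyperplane_le) auto
  then obtain L' where L': "L' \<subseteq> L" "convex hull L \<inter> {p. n \<bullet> p = b} = convex hull L'"
    using face_of_convex_hull_subset finite_imp_compact[OF assms(1)] by metis
  then have "L' \<subseteq> L \<inter> {p. n \<bullet> p = b}"
    using hull_subset[of L' convex] by blast
  then show "convex hull L \<inter> {p. n \<bullet> p = b} \<subseteq> convex hull (L \<inter> {p. n \<bullet> p = b})"
    unfolding L'(2) by (rule hull_mono)
  show "convex hull (L \<inter> {p. n \<bullet> p = b}) \<subseteq> convex hull L \<inter> {p. n \<bullet> p = b}"
    by (intro Int_greatest hull_mono hull_minimal convex_hyperplane) auto
qed

lemma lifted_points_eq:
  assumes "\<delta> \<ge> 1"
  shows "lifted_points \<delta> \<omega> = (\<lambda>a. (emb a, \<omega> a)) ` lattice_points \<delta>"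
proof -
  have "(real_of_int i, real_of_int j) \<in> dilated_simplex \<delta> \<longleftrightarrow> (i, j) \<in> lattice_points \<delta>" for i j
    using emb_in_dilated_simplex[OF assms, of "(i, j)"] by (simp add: emb_def)
  then show ?thesis
    by (force simp: lifted_points_def emb_def image_iff)
qed

text \<open>The hyperplane is the graph of the affine function given by \<open>c\<close> and
  \<open>d\<close>; the factor \<open>e\<close> covers all lengths of a downward normal.\<close>

lemma fst_image_supporting:
  assumes \<delta>: "\<delta> \<ge> 1" and e: "e > 0"
    and le: "\<And>a. a \<in> lattice_points \<delta> \<Longrightarrow> c \<bullet> emb a + d \<le> \<omega> a"
  shows "fst ` (convex hull (lifted_points \<delta> \<omega>) \<inter> {p. (e *\<^sub>R c, - e) \<bullet> p = - e * d}) =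
    convex hull (emb ` contact \<delta> \<omega> c d)"
proof -
  have diff: "(e *\<^sub>R c, - e) \<bullet> (emb a, \<omega> a) - (- e * d) = e * (c \<bullet> emb a + d - \<omega> a)" for a
    by (simp add: algebra_simps)
  have "(e *\<^sub>R c, - e) \<bullet> (emb a, \<omega> a) \<le> - e * d" if "a \<in> lattice_points \<delta>" for a
    using diff[of a] e le[OF that] mult_nonneg_nonpos[of e "c \<bullet> emb a + d - \<omega> a"] by linarith
  then have "convex hull (lifted_points \<delta> \<omega>) \<inter> {p. (e *\<^sub>R c, - e) \<bullet> p = - e * d} =
      convex hull (lifted_points \<delta> \<omega> \<inter> {p. (e *\<^sub>R c, - e) \<bullet> p = - e * d})"
    by (intro supporting_convex_hull)
      (auto simp: lifted_points_eq[OF \<delta>] finite_lattice_points)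
  moreover have "(e *\<^sub>R c, - e) \<bullet> (emb a, \<omega> a) = - e * d \<longleftrightarrow> c \<bullet> emb a + d = \<omega> a" for a
    using diff[of a] e by (smt (verit) mult_eq_0_iff)
  then have "lifted_points \<delta> \<omega> \<inter> {p. (e *\<^sub>R c, - e) \<bullet> p = - e * d} =
      (\<lambda>a. (emb a, \<omega> a)) ` contact \<delta> \<omega> c d"
    by (auto simp: lifted_points_eq[OF \<delta>] contact_def simp del: inner_Pair)
  ultimately show ?thesis
    by (simp add: convex_hull_linear_image[OF linear_fst] image_image)
qed

lemma lower_cells_eq:
  assumes \<delta>: "\<delta> \<ge> 1"
  shows "(\<lambda>F. fst ` F) ` lower_faces (convex hull (lifted_points \<delta> \<omega>)) =
    {convex hull (emb ` contact \<delta> \<omega> c d) | c d.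
      (\<forall>a\<in>lattice_points \<delta>. c \<bullet> emb a + d \<le> \<omega> a) \<and> contact \<delta> \<omega> c d \<noteq> {}}"
    (is "?L = ?R")
proof (intro equalityI subsetI)
  let ?P = "convex hull (lifted_points \<delta> \<omega>)"
  fix C assume "C \<in> ?L"
  then obtain n b where n: "snd n < 0" "?P \<subseteq> {p. n \<bullet> p \<le> b}" "?P \<inter> {p. n \<bullet> p = b} \<noteq> {}"
    and C: "C = fst ` (?P \<inter> {p. n \<bullet> p = b})"
    unfolding lower_faces_def by blast
  \<comment> \<open>Solving the hyperplane equation for the last coordinate.\<close>
  define e c d where "e = - snd n" and "c = (1 / e) *\<^sub>R fst n" and "d = - b / e"
  have e: "e > 0" using n(1) by (simp add: e_def)
  have n_eq: "n = (e *\<^sub>R c, - e)" and b_eq: "b = - e * d"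
    using e by (auto simp: c_def d_def) (simp add: e_def)
  have le: "c \<bullet> emb a + d \<le> \<omega> a" if "a \<in> lattice_points \<delta>" for a
  proof -
    have "(emb a, \<omega> a) \<in> ?P" using that by (auto simp: lifted_points_eq[OF \<delta>] intro: hull_inc)
    then have "n \<bullet> (emb a, \<omega> a) \<le> b" using n(2) by blast
    then have "e * (c \<bullet> emb a + d) \<le> e * \<omega> a" by (simp add: n_eq b_eq algebra_simps)
    then show ?thesis using e by simp
  qed
  have "C = convex hull (emb ` contact \<delta> \<omega> c d)"
    unfolding C n_eq b_eq by (rule fst_image_supporting[OF \<delta> e le])
  moreover from this have "contact \<delta> \<omega> c d \<noteq> {}" using n(3) C by auto
  ultimately show "C \<in> ?R" using le by blast
next
  let ?P = "convex hull (lifted_points \<delta> \<omega>)"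
  fix C assume "C \<in> ?R"
  then obtain c d where C: "C = convex hull (emb ` contact \<delta> \<omega> c d)" "contact \<delta> \<omega> c d \<noteq> {}"
    and le: "\<And>a. a \<in> lattice_points \<delta> \<Longrightarrow> c \<bullet> emb a + d \<le> \<omega> a" by blast
  let ?n = "(1 *\<^sub>R c, - 1 :: real)" and ?b = "- 1 * d"
  have C': "C = fst ` (?P \<inter> {p. ?n \<bullet> p = ?b})"
    unfolding C(1) by (rule fst_image_supporting[OF \<delta> _ le, symmetric]) auto
  moreover have "?P \<inter> {p. ?n \<bullet> p = ?b} \<noteq> {}"
    using C(2) C' unfolding C(1) by auto
  moreover have "lifted_points \<delta> \<omega> \<subseteq> {p. ?n \<bullet> p \<le> ?b}"
    using le by (auto simp: lifted_points_eq[OF \<delta>] algebra_simps)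
  then have "?P \<subseteq> {p. ?n \<bullet> p \<le> ?b}"
    by (intro hull_minimal convex_halfspace_le)
  moreover have "snd ?n < 0" by simp
  ultimately show "C \<in> ?L"
    unfolding lower_faces_def by blast
qed

section \<open>Local convexity yields the honeycomb\<close>

text \<open>Each inequality compares two pairs of points with the same midpoint, so affine functions
  cancel.\<close>

lemma locally_convex_minus_affine:
  assumes "locally_convex \<delta> f"
  shows "locally_convex \<delta> (\<lambda>a. f a - (c \<bullet> emb a + d))"
proof -
  obtain c1 c2 where "c = (c1, c2)" by (cases c)
  then show ?thesis
    unfolding locally_convex_def using locally_convexD[OF assms]
    by (simp add: emb_def algebra_simps)
qed

lemma affine_less_off_triangle:
  assumes "locally_convex \<delta> \<omega>" "\<sigma> = 1 \<or> \<sigma> = -1" "tri \<sigma> p q \<subseteq> lattice_points \<delta>"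
    and "\<forall>v\<in>tri \<sigma> p q. c \<bullet> emb v + d = \<omega> v"
    and "a \<in> lattice_points \<delta>" "a \<notin> tri \<sigma> p q"
  shows "c \<bullet> emb a + d < \<omega> a"
  using pos_off_triangle[OF locally_convex_minus_affine[OF assms(1), of c d] assms(2,3) _ assms(5,6)]
    assms(4) by simp

lemma ex_contact_eq:
  assumes f: "locally_convex \<delta> \<omega>" and V: "V \<in> honeycomb_cells \<delta>"
  shows "\<exists>c d. (\<forall>a\<in>lattice_points \<delta>. c \<bullet> emb a + d \<le> \<omega> a) \<and> contact \<delta> \<omega> c d = V"
proof -
  obtain \<sigma> p q where \<sigma>: "\<sigma> = 1 \<or> \<sigma> = -1" and T: "tri \<sigma> p q \<subseteq> lattice_points \<delta>"
    and VT: "V \<subseteq> tri \<sigma> p q" using V unfolding honeycomb_cells_def by blast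
  obtain c d where cd: "\<forall>v\<in>tri \<sigma> p q. c \<bullet> emb v + d = \<omega> v"
    using interpolate[OF \<sigma>, of p q \<omega>] by blast
  \<comment> \<open>The tilt: subtracting a small positive multiple of this function keeps contact
    on \<open>V\<close> and breaks it at the other vertices.\<close>
  obtain c' d' where cd': "\<forall>v\<in>tri \<sigma> p q. c' \<bullet> emb v + d' = (if v \<in> V then 0 else 1)"
    using interpolate[OF \<sigma>, of p q "\<lambda>v. if v \<in> V then 0 else 1"] by blast
  \<comment> \<open>The inequalities off the triangle are strict and finite in number, so they
    survive a small tilt.\<close>
  have "\<forall>\<^sub>F e in at_right 0. c \<bullet> emb a + d - e * (c' \<bullet> emb a + d') < \<omega> a"
    if "a \<in> lattice_points \<delta> - tri \<sigma> p q" for a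
  proof (rule order_tendstoD)
    show "((\<lambda>e. c \<bullet> emb a + d - e * (c' \<bullet> emb a + d')) \<longlongrightarrow>
        c \<bullet> emb a + d - 0 * (c' \<bullet> emb a + d')) (at_right 0)"
      by (intro tendsto_intros)
    show "c \<bullet> emb a + d - 0 * (c' \<bullet> emb a + d') < \<omega> a"
      using affine_less_off_triangle[OF f \<sigma> T cd] that by simp
  qed
  then have "\<forall>\<^sub>F e in at_right 0. \<forall>a\<in>lattice_points \<delta> - tri \<sigma> p q.
      c \<bullet> emb a + d - e * (c' \<bullet> emb a + d') < \<omega> a"
    by (intro eventually_ball_finite) (auto simp: finite_lattice_points)
  moreover have "\<forall>\<^sub>F e in at_right 0. 0 < (e :: real)"
    by (rule eventually_at_right_less)
  ultimately have "\<forall>\<^sub>F e in at_right 0. 0 < e \<and> (\<forall>a\<in>lattice_points \<delta> - tri \<sigma> p q.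
      c \<bullet> emb a + d - e * (c' \<bullet> emb a + d') < \<omega> a)"
    by eventually_elim simp
  then obtain e where e: "0 < e"
    and off: "\<And>a. a \<in> lattice_points \<delta> - tri \<sigma> p q \<Longrightarrow>
      c \<bullet> emb a + d - e * (c' \<bullet> emb a + d') < \<omega> a"
    using eventually_happens'[OF trivial_limit_at_right_real] by blast
  have eq: "(c - e *\<^sub>R c') \<bullet> emb a + (d - e * d') = c \<bullet> emb a + d - e * (c' \<bullet> emb a + d')" for a
    by (simp add: algebra_simps)
  have on: "(c - e *\<^sub>R c') \<bullet> emb a + (d - e * d') = \<omega> a - (if a \<in> V then 0 else e)"
    if "a \<in> tri \<sigma> p q" for a
    using cd cd' that unfolding eq by simp
  show ?thesis
  proof (intro exI conjI ballI)
    fix a assume "a \<in> lattice_points \<delta>"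
    then show "(c - e *\<^sub>R c') \<bullet> emb a + (d - e * d') \<le> \<omega> a"
      using on[of a] off[of a] e eq[of a] by (cases "a \<in> tri \<sigma> p q") auto
  next
    have "(c - e *\<^sub>R c') \<bullet> emb a + (d - e * d') = \<omega> a \<longleftrightarrow> a \<in> V" if "a \<in> lattice_points \<delta>" for a
      using on[of a] off[of a] e eq[of a] VT that by (cases "a \<in> tri \<sigma> p q") auto
    then show "contact \<delta> \<omega> (c - e *\<^sub>R c') (d - e * d') = V"
      using VT T by (auto simp: contact_def)
  qed
qed

lemma contact_in_honeycomb_cells:
  assumes \<delta>: "\<delta> \<ge> 1" and f: "locally_convex \<delta> \<omega>"
    and le: "\<And>a. a \<in> lattice_points \<delta> \<Longrightarrow> c \<bullet> emb a + d \<le> \<omega> a"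
    and ne: "contact \<delta> \<omega> c d \<noteq> {}"
  shows "contact \<delta> \<omega> c d \<in> honeycomb_cells \<delta>"
proof -
  let ?Z = "contact \<delta> \<omega> c d"
  have Z: "?Z \<subseteq> lattice_points \<delta>" by (auto simp: contact_def)
  then have finZ: "finite ?Z" using finite_lattice_points finite_subset by blast
  define w where "w = 1 / real (card ?Z)"
  have w: "0 < w" "(\<Sum>a\<in>?Z. w) = 1"
    using ne finZ by (auto simp: w_def card_gt_0_iff)
  define x where "x = (\<Sum>a\<in>?Z. w *\<^sub>R emb a)"
  have "x \<in> convex hull (emb ` ?Z)"
    unfolding x_def using finZ w by (intro convex_sum) (auto intro: hull_inc)
  then have "x \<in> dilated_simplex \<delta>" using convex_hull_emb_subset[OF \<delta> Z] by blast
  from ex_triangle[OF \<delta> this] obtain \<sigma> p q where \<sigma>: "\<sigma> = 1 \<or> \<sigma> = -1"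
    and T: "tri \<sigma> p q \<subseteq> lattice_points \<delta>" and x0: "\<forall>v\<in>tri \<sigma> p q. 0 \<le> bary \<sigma> p q v x" by blast
  obtain c' d' where cd': "\<forall>v\<in>tri \<sigma> p q. c' \<bullet> emb v + d' = \<omega> v"
    using interpolate[OF \<sigma>, of p q \<omega>] by blast
  note off = affine_less_off_triangle[OF f \<sigma> T cd']
  have at_x: "r \<bullet> x + s = (\<Sum>v\<in>tri \<sigma> p q. bary \<sigma> p q v x * (r \<bullet> emb v + s))" for r s
    using affine_sum[OF sum_bary[OF \<sigma>], of r p q x emb s] by (simp add: sum_bary_scaleR[OF \<sigma>])
  have at_x': "r \<bullet> x + s = (\<Sum>a\<in>?Z. w * (r \<bullet> emb a + s))" for r s
    unfolding x_def by (rule affine_sum[OF w(2)])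
  have "(\<Sum>a\<in>?Z. w * \<omega> a) = c \<bullet> x + d"
    unfolding at_x' by (intro sum.cong) (auto simp: contact_def)
  \<comment> \<open>At the vertices the first function is at most \<open>\<omega>\<close>, which the
    second one interpolates; \<open>x\<close> is a convex combination of them.\<close>
  also have "\<dots> \<le> c' \<bullet> x + d'"
    unfolding at_x using x0 le T cd' by (intro sum_mono mult_left_mono) auto
  finally have ge: "(\<Sum>a\<in>?Z. w * \<omega> a) \<le> (\<Sum>a\<in>?Z. w * (c' \<bullet> emb a + d'))"
    unfolding at_x' .
  \<comment> \<open>A contact point off the triangle would make the average of
    \<open>\<omega>\<close> over \<open>?Z\<close> strictly exceed that of the interpolating
    function, against \<open>ge\<close>.\<close>
  have "?Z \<subseteq> tri \<sigma> p q"
  proof (rule ccontr)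
    assume "\<not> ?Z \<subseteq> tri \<sigma> p q"
    then have "\<exists>a\<in>?Z. w * (c' \<bullet> emb a + d') < w * \<omega> a"
      using off Z w(1) by auto
    moreover have "\<forall>a\<in>?Z. w * (c' \<bullet> emb a + d') \<le> w * \<omega> a"
      using off Z w(1) cd' by (auto simp: less_eq_real_def)
    ultimately have "(\<Sum>a\<in>?Z. w * (c' \<bullet> emb a + d')) < (\<Sum>a\<in>?Z. w * \<omega> a)"
      using finZ by (intro sum_strict_mono_ex1) auto
    then show False using ge by simp
  qed
  then show ?thesis unfolding honeycomb_cells_def using ne \<sigma> T by blast
qed

section \<open>The honeycomb forces local convexity\<close>

text \<open>The intended \<open>r\<close> and \<open>s\<close> are the vertices opposite to the edge
  from \<open>u\<close> to \<open>v\<close> in its two triangles, the four points forming a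
  parallelogram. An affine function touching \<open>\<omega>\<close> along the edge lies strictly
  below it at \<open>r\<close>.\<close>

lemma flip_inequality:
  assumes \<delta>: "\<delta> \<ge> 1" and ind: "induces_triangulation \<delta> \<omega> (honeycomb_triangulation \<delta>)"
    and cell: "{u, v} \<in> honeycomb_cells \<delta>"
    and lat: "r \<in> lattice_points \<delta>" "s \<in> lattice_points \<delta>"
    and sum: "emb r + emb s = emb u + emb v"
    and off: "emb r \<notin> closed_segment (emb u) (emb v)"
  shows "\<omega> u + \<omega> v < \<omega> r + \<omega> s"
proof -
  have inj: "emb a = emb b \<longleftrightarrow> a = b" for a b by (auto simp: emb_def prod_eq_iff)
  have "convex hull (emb ` {u, v}) \<in> honeycomb_triangulation \<delta>"
    unfolding honeycomb_triangulation_eq[OF \<delta>] using cell by blast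
  then have "convex hull (emb ` {u, v}) \<in> {convex hull (emb ` contact \<delta> \<omega> c d) | c d.
      (\<forall>a\<in>lattice_points \<delta>. c \<bullet> emb a + d \<le> \<omega> a) \<and> contact \<delta> \<omega> c d \<noteq> {}}"
    using ind unfolding induces_triangulation_def lower_cells_eq[OF \<delta>] by simp
  then obtain c d where le: "\<And>a. a \<in> lattice_points \<delta> \<Longrightarrow> c \<bullet> emb a + d \<le> \<omega> a"
    and "convex hull (emb ` contact \<delta> \<omega> c d) = convex hull (emb ` {u, v})"
    by blast
  then have hull: "convex hull (emb ` contact \<delta> \<omega> c d) = closed_segment (emb u) (emb v)"
    by (simp add: segment_convex_hull)
  \<comment> \<open>Only the hulls are known to agree; extreme points bring \<open>u\<close> and
    \<open>v\<close> back into the contact set.\<close>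
  have "emb u extreme_point_of convex hull (emb ` contact \<delta> \<omega> c d)"
    "emb v extreme_point_of convex hull (emb ` contact \<delta> \<omega> c d)"
    unfolding hull by (simp_all add: extreme_point_of_segment)
  then have "emb u \<in> emb ` contact \<delta> \<omega> c d" "emb v \<in> emb ` contact \<delta> \<omega> c d"
    by (auto dest: extreme_point_of_convex_hull)
  then have uv: "c \<bullet> emb u + d = \<omega> u" "c \<bullet> emb v + d = \<omega> v"
    by (auto simp: contact_def inj)
  have "r \<notin> contact \<delta> \<omega> c d"
    using off hull hull_inc[of "emb r" "emb ` contact \<delta> \<omega> c d" convex] by blast
  then have "c \<bullet> emb r + d < \<omega> r"
    using le[OF lat(1)] lat(1) by (auto simp: contact_def)
  moreover have "c \<bullet> emb r + c \<bullet> emb s = c \<bullet> emb u + c \<bullet> emb v"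
    unfolding inner_add_right[symmetric] sum ..
  ultimately show ?thesis using le[OF lat(2)] uv by linarith
qed

lemma induces_triangulation_iff:
  assumes \<delta>: "\<delta> \<ge> 1"
  shows "induces_triangulation \<delta> \<omega> (honeycomb_triangulation \<delta>) \<longleftrightarrow> locally_convex \<delta> \<omega>"
proof
  assume f: "locally_convex \<delta> \<omega>"
  show "induces_triangulation \<delta> \<omega> (honeycomb_triangulation \<delta>)"
    unfolding induces_triangulation_def lower_cells_eq[OF \<delta>] honeycomb_triangulation_eq[OF \<delta>]
  proof (intro equalityI subsetI)
    fix C assume "C \<in> (\<lambda>V. convex hull (emb ` V)) ` honeycomb_cells \<delta>"
    then obtain V where V: "V \<in> honeycomb_cells \<delta>" "C = convex hull (emb ` V)" by blast
    moreover have "V \<noteq> {}" using V(1) by (simp add: honeycomb_cells_def)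
    ultimately show "C \<in> {convex hull (emb ` contact \<delta> \<omega> c d) | c d.
        (\<forall>a\<in>lattice_points \<delta>. c \<bullet> emb a + d \<le> \<omega> a) \<and> contact \<delta> \<omega> c d \<noteq> {}}"
      using ex_contact_eq[OF f V(1)] by blast
  qed (use contact_in_honeycomb_cells[OF \<delta> f] in blast)
next
  assume ind: "induces_triangulation \<delta> \<omega> (honeycomb_triangulation \<delta>)"
  show "locally_convex \<delta> \<omega>"
    unfolding locally_convex_def
  proof (intro allI impI conjI)
    fix i j :: int
    assume ij: "0 \<le> i \<and> 0 \<le> j \<and> i + j + 2 \<le> \<delta>"
    \<comment> \<open>The three inequalities at \<open>(i, j)\<close> belong to the three edges of
      this one triangle.\<close>
    have T: "tri (-1) (i + 1) (j + 1) \<subseteq> lattice_points \<delta>"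
      using ij by (auto simp: tri_def lattice_points_def)
    have cell: "V \<in> honeycomb_cells \<delta>" if "V \<noteq> {}" "V \<subseteq> {(i + 1, j + 1), (i, j + 1), (i + 1, j)}" for V
    proof -
      have "V \<subseteq> tri (-1) (i + 1) (j + 1)" using that(2) by (auto simp: tri_def)
      then show ?thesis using that(1) T unfolding honeycomb_cells_def by blast
    qed
    note flip = flip_inequality[OF \<delta> ind cell]
    show "\<omega> (i, j + 1) + \<omega> (i + 1, j) < \<omega> (i, j) + \<omega> (i + 1, j + 1)"
      by (rule flip) (use ij in \<open>auto simp: lattice_points_def emb_def in_segment algebra_simps\<close>)
    show "\<omega> (i + 1, j) + \<omega> (i + 1, j + 1) < \<omega> (i, j + 1) + \<omega> (i + 2, j)"
      by (rule flip) (use ij in \<open>auto simp: lattice_points_def emb_def in_segment algebra_simps\<close>)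
    show "\<omega> (i, j + 1) + \<omega> (i + 1, j + 1) < \<omega> (i + 1, j) + \<omega> (i, j + 2)"
      by (rule flip) (use ij in \<open>auto simp: lattice_points_def emb_def in_segment algebra_simps\<close>)
  qed
qed

theorem proposition10:
  fixes \<delta> :: int and \<omega> :: "int \<times> int \<Rightarrow> real"
  assumes "\<delta> \<ge> 1"
  shows "induces_triangulation \<delta> \<omega> (honeycomb_triangulation \<delta>) \<longleftrightarrow>
    (\<forall>i j. i \<ge> 1 \<and> j \<ge> 1 \<and> i + j \<le> \<delta> \<longrightarrow>
       \<omega> (i - 1, j - 1) + \<omega> (i, j) > \<omega> (i - 1, j) + \<omega> (i, j - 1) \<and>
       \<omega> (i - 1, j) + \<omega> (i + 1, j - 1) > \<omega> (i, j - 1) + \<omega> (i, j) \<and>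
       \<omega> (i, j - 1) + \<omega> (i - 1, j + 1) > \<omega> (i - 1, j) + \<omega> (i, j))"
    (is "_ \<longleftrightarrow> (\<forall>i j. ?P i j)")
proof -
  have "locally_convex \<delta> \<omega> \<longleftrightarrow> (\<forall>i j. ?P (i + 1) (j + 1))"
    unfolding locally_convex_def by (simp add: algebra_simps)
  also have "\<dots> \<longleftrightarrow> (\<forall>i j. ?P i j)"
    by (metis diff_add_cancel)
  finally show ?thesis
    by (simp only: induces_triangulation_iff[OF assms])
qed

end
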